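(* Let $p,q\in\mathbb{Z}$ with $\min\{p+q,\,p-q\}\geq 0$. Then \[ \frac{4^{p+1}}{\sqrt{2}\,\pi}=\sum_{k=0}^{\infty}\frac{(\frac{1}{2})_{k+2p}(\frac{1}{2})_{k+2q}(\frac{1}{2})_{k-2q}} {k!\,(k+p+q)!\,(k+p-q)!}\cdot\frac{6k+4p+1}{(-8)^k}. \]
   Context: For a complex number $x$ and an integer $n$ (possibly negative), the shifted factorial is defined by $(x)_n=\Gamma(x+n)/\Gamma(x)$, where $\Gamma$ is the Gamma function. *)

theory Defs
  imports "HOL-Analysis.Analysis"
begin

(* An integer-index version of the library's pochhammer. At poles of Gamma the library's
   convention is Gamma z = 0, so the value is only meaningful if neither x nor x + n is a
   non-positive integer; this holds for every n when x = 1/2. *)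
definition shifted_factorial :: "complex \<Rightarrow> int \<Rightarrow> complex" where
  "shifted_factorial x n = Gamma (x + of_int n) / Gamma x"

end

theory Submission
  imports Defs "HOL-Real_Asymp.Real_Asymp"
begin

text \<open>
  The series is the limiting case of a strange evaluation of Gessel and Stanton, taken at
  a = p + 1/4 and b = q + 1/4. With c(a, k) and t(a, k) the functions gs_coeff and gs_term
  below, (t(a + 1, k) - rho(a) t(a, k), 2 k c(a, k) rho(a) / (2 a)) is a WZ pair with
  rho(a) = (a - b + 1)(a + b + 1/2) / ((a + 1/2)(a + 1)), so the sum S(a) satisfies
  S(a + 1) = rho(a) S(a). As n tends to infinity, every term of S(a + n) but the 0-th tends to 0,
  hence S(a + n) tends to 1 by dominated convergence, and S(a) is the reciprocal of the infinite
  product of rho(a + n), a quotient of Gamma values.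
\<close>

section \<open>The summand and its shift quotients in \<open>k\<close> and \<open>a\<close>\<close>

definition gs_coeff :: "real \<Rightarrow> real \<Rightarrow> nat \<Rightarrow> real" where
  "gs_coeff a b k =
     pochhammer (2 * a) k * pochhammer (2 * b) k * pochhammer (1 - 2 * b) k * (- 1 / 8) ^ k /
     (fact k * pochhammer (a - b + 1) k * pochhammer (a + b + 1 / 2) k)"

text \<open>Dividing the linear factor by \<open>2 * a\<close> normalises the 0-th term to 1 for
  nonzero \<open>a\<close>; this is what makes the sum tend to 1 as \<open>a\<close> grows.\<close>

definition gs_term :: "real \<Rightarrow> real \<Rightarrow> nat \<Rightarrow> real" where
  "gs_term a b k = (2 * a + 3 * real k) / (2 * a) * gs_coeff a b k"

lemma gs_coeff_0 [simp]: "gs_coeff a b 0 = 1"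
  by (simp add: gs_coeff_def)

lemma gs_coeff_Suc:
  "gs_coeff a b (Suc k) = gs_coeff a b k *
     (- ((2 * a + k) * (2 * b + k) * (1 - 2 * b + k)) /
      (8 * (k + 1) * (a - b + 1 + k) * (a + b + 1 / 2 + k)))"
  by (simp add: gs_coeff_def pochhammer_Suc mult_ac add_ac del: distrib_left_numeral distrib_right_numeral)

lemma pochhammer_plus1:
  fixes z :: real
  assumes "z \<noteq> 0"
  shows "pochhammer (z + 1) k = pochhammer z k * ((z + k) / z)"
  using pochhammer_rec[of z k] pochhammer_Suc[of z k] assms by (simp add: field_simps)

lemma gs_coeff_plus1:
  assumes "a > 0" "a - b + 1 > 0" "a + b + 1 / 2 > 0"
  shows "gs_coeff (a + 1) b k = gs_coeff a b k *
     ((2 * a + k) * (2 * a + 1 + k) * (a - b + 1) * (a + b + 1 / 2) /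
      (2 * a * (2 * a + 1) * (a - b + 1 + k) * (a + b + 1 / 2 + k)))"
proof -
  \<comment> \<open>Here the base moves by 2 and not by 1, so the shift rule is applied
    twice.\<close>
  have 1: "pochhammer (2 * (a + 1)) k =
      pochhammer (2 * a) k * ((2 * a + k) / (2 * a)) * ((2 * a + 1 + k) / (2 * a + 1))"
    using pochhammer_plus1[of "2 * a" k] pochhammer_plus1[of "2 * a + 1" k] assms
    by (simp add: algebra_simps)
  have 2: "pochhammer (a + 1 - b + 1) k =
      pochhammer (a - b + 1) k * ((a - b + 1 + k) / (a - b + 1))"
    using pochhammer_plus1[of "a - b + 1" k] assms by (simp add: algebra_simps)
  have 3: "pochhammer (a + 1 + b + 1 / 2) k =
      pochhammer (a + b + 1 / 2) k * ((a + b + 1 / 2 + k) / (a + b + 1 / 2))"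
    using pochhammer_plus1[of "a + b + 1 / 2" k] assms by (simp add: algebra_simps)
  show ?thesis
    unfolding gs_coeff_def 1 2 3 using assms(2,3)
    by (simp add: mult_ac del: distrib_left_numeral distrib_right_numeral)
qed

section \<open>The WZ identity and the recurrence for the sum\<close>

text \<open>After \<open>\<rho> / a * gs_coeff a b k\<close> is split off, only rational functions
  of \<open>k\<close> with denominator \<open>8 * A * B\<close> remain, and the claim becomes the
  polynomial identity behind \<open>id\<close>. The right-hand side telescopes in
  \<open>k\<close>.\<close>

lemma gs_wz:
  assumes "a > 0" "a - b + 1 > 0" "a + b + 1 / 2 > 0"
  defines "\<rho> \<equiv> (a - b + 1) * (a + b + 1 / 2) / ((a + 1 / 2) * (a + 1))"
  shows "gs_term (a + 1) b k - \<rho> * gs_term a b k =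
     \<rho> / a * (real (Suc k) * gs_coeff a b (Suc k) - real k * gs_coeff a b k)"
proof -
  define A where "A = a - b + 1 + k"
  define B where "B = a + b + 1 / 2 + k"
  have pos: "A > 0" "B > 0" using assms by (auto simp: A_def B_def)
  have t: "gs_term (a + 1) b k = \<rho> / a * gs_coeff a b k *
      ((2 * a + k) * (2 * a + 1 + k) * (2 * a + 2 + 3 * k) / (8 * A * B))"
    unfolding gs_term_def gs_coeff_plus1[OF assms(1-3)] \<rho>_def A_def[symmetric] B_def[symmetric]
    using assms(1) pos by (simp add: divide_simps) (simp add: algebra_simps)?
  have s: "real (Suc k) * gs_coeff a b (Suc k) =
      gs_coeff a b k * (- ((2 * a + k) * (2 * b + k) * (1 - 2 * b + k)) / (8 * A * B))"
    unfolding gs_coeff_Suc A_def[symmetric] B_def[symmetric] using pos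
    by (simp add: divide_simps) (simp add: algebra_simps)?
  have id: "(2 * a + k) * (2 * a + 1 + k) * (2 * a + 2 + 3 * k) / (8 * A * B) - (2 * a + 3 * k) / 2 =
      - ((2 * a + k) * (2 * b + k) * (1 - 2 * b + k)) / (8 * A * B) - k"
  proof -
    \<comment> \<open>Denominators are cleared with the numerators kept as variables and
      \<open>A\<close>, \<open>B\<close> folded; they are expanded only afterwards, in a pure
      polynomial identity.\<close>
    have clear: "P / (8 * A * B) - L / 2 = N / (8 * A * B) - K"
      if "P - 4 * A * B * L = N - K * (8 * A * B)" for P L N K :: real
      using that pos by (simp add: field_simps)
    have "(2 * a + k) * (2 * a + 1 + k) * (2 * a + 2 + 3 * k) - 4 * A * B * (2 * a + 3 * k) =
      - ((2 * a + k) * (2 * b + k) * (1 - 2 * b + k)) - k * (8 * A * B)"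
      unfolding A_def B_def by (simp add: field_simps)
    thus ?thesis by (rule clear)
  qed
  have "gs_term (a + 1) b k - \<rho> * gs_term a b k = \<rho> / a * gs_coeff a b k *
     ((2 * a + k) * (2 * a + 1 + k) * (2 * a + 2 + 3 * k) / (8 * A * B) - (2 * a + 3 * k) / 2)"
    unfolding t using assms(1) by (simp add: gs_term_def right_diff_distrib mult_ac)
  thus ?thesis unfolding id s by (simp add: algebra_simps)
qed

text \<open>The quotient of consecutive terms is \<open>- r k\<close>, which tends to -1/8, so the
  ratio test applies with 1/2.\<close>

lemma summable_gs_term:
  assumes "a > 0" "a - b + 1 > 0" "a + b + 1 / 2 > 0"
  shows "summable (gs_term a b)"
proof -
  define r where "r k = (2 * a + 3 * (real k + 1)) / (2 * a + 3 * real k) *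
     (((2 * a + k) * (2 * b + k) * (1 - 2 * b + k)) /
      (8 * (real k + 1) * (a - b + 1 + k) * (a + b + 1 / 2 + k)))" for k
  have r: "gs_term a b (Suc k) = - r k * gs_term a b k" for k
  proof -
    have "2 * a + 3 * real k > 0" using assms by (simp add: add_pos_nonneg)
    thus ?thesis
      unfolding gs_term_def gs_coeff_Suc r_def by (simp add: add_ac mult_ac)
  qed
  have "(\<lambda>k. \<bar>r k\<bar>) \<longlonglongrightarrow> \<bar>1 / 8\<bar>"
    unfolding r_def by (intro tendsto_rabs) real_asymp
  hence "eventually (\<lambda>k. \<bar>r k\<bar> < 1 / 2) sequentially"
    by (rule order_tendstoD) simp
  then obtain N where N: "\<And>k. k \<ge> N \<Longrightarrow> \<bar>r k\<bar> < 1 / 2"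
    by (auto simp: eventually_sequentially)
  show ?thesis
  proof (rule summable_ratio_test[of "1 / 2" N])
    fix k assume "k \<ge> N"
    thus "norm (gs_term a b (Suc k)) \<le> 1 / 2 * norm (gs_term a b k)"
      unfolding r
      using mult_right_mono[OF less_imp_le[OF N[of k]], of "\<bar>gs_term a b k\<bar>"] by (simp add: abs_mult)
  qed simp
qed

text \<open>The WZ identity is summed over \<open>k\<close>. The right-hand side contributes 0: the
  factor \<open>real k\<close> removes the boundary term at 0, and the one at infinity vanishes
  because the terms of a convergent series tend to 0.\<close>

lemma suminf_gs_term_plus1:
  assumes "a > 0" "a - b + 1 > 0" "a + b + 1 / 2 > 0"
  shows "suminf (gs_term (a + 1) b) =
    (a - b + 1) * (a + b + 1 / 2) / ((a + 1 / 2) * (a + 1)) * suminf (gs_term a b)"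
proof -
  define \<rho> where "\<rho> = (a - b + 1) * (a + b + 1 / 2) / ((a + 1 / 2) * (a + 1))"
  have "(\<lambda>k. 2 * a * gs_term a b k) \<longlonglongrightarrow> 2 * a * 0"
    by (intro tendsto_intros summable_LIMSEQ_zero summable_gs_term assms)
  hence "(\<lambda>k. 2 * a * gs_term a b k) \<longlonglongrightarrow> 0" by simp
  hence "(\<lambda>k. real k * gs_coeff a b k) \<longlonglongrightarrow> 0"
  proof (rule Lim_null_comparison[rotated, OF tendsto_norm_zero], intro always_eventually allI)
    fix k
    \<comment> \<open>The linear factor of \<open>gs_term\<close> dominates \<open>real k\<close>,
      so the certificate inherits the decay of the terms.\<close>
    have "real k * \<bar>gs_coeff a b k\<bar> \<le> (2 * a + 3 * real k) * \<bar>gs_coeff a b k\<bar>"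
      using assms by (intro mult_right_mono) auto
    thus "norm (real k * gs_coeff a b k) \<le> norm (2 * a * gs_term a b k)"
      using assms by (simp add: gs_term_def abs_mult)
  qed
  from sums_mult[OF telescope_sums[OF this], of "\<rho> / a"]
  have "(\<lambda>k. gs_term (a + 1) b k - \<rho> * gs_term a b k) sums 0"
    unfolding gs_wz[OF assms, folded \<rho>_def] by simp
  from sums_add[OF this sums_mult[OF summable_sums[OF summable_gs_term[OF assms]], of \<rho>]]
  have "gs_term (a + 1) b sums (\<rho> * suminf (gs_term a b))" by simp
  thus ?thesis unfolding \<rho>_def by (rule sums_unique[symmetric])
qed

lemma suminf_gs_term_plus_nat:
  assumes "a > 0" "a - b + 1 > 0" "a + b + 1 / 2 > 0"
  shows "suminf (gs_term (a + real n) b) =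
    pochhammer (a - b + 1) n * pochhammer (a + b + 1 / 2) n /
    (pochhammer (a + 1 / 2) n * pochhammer (a + 1) n) * suminf (gs_term a b)"
proof (induction n)
  case (Suc n)
  \<comment> \<open>These equations turn the recurrence factor at \<open>a + real n\<close> into the
    last factors of the four Pochhammer symbols.\<close>
  have "a + real (Suc n) = a + real n + 1" "a + real n - b + 1 = a - b + 1 + n"
    "a + real n + b + 1 / 2 = a + b + 1 / 2 + n" "a + real n + 1 / 2 = a + 1 / 2 + n"
    "a + real n + 1 = a + 1 + n"
    by simp_all
  thus ?case
    using suminf_gs_term_plus1[of "a + real n" b] assms
    by (simp only: Suc pochhammer_Suc) (simp add: mult_ac)
qed simp

section \<open>Dominated convergence as \<open>a\<close> tends to infinity\<close>

text \<open>The bound is free of \<open>a\<close>, as a majorant must be, and for fixed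
  \<open>b\<close> the hypotheses hold for all large \<open>a\<close>. In the quotient of
  consecutive coefficients, \<open>2 * a + k\<close> is at most \<open>4 * A\<close> and the two
  factors with \<open>b\<close> are together at most \<open>(k + 1) * B\<close>, which leaves
  4/8.\<close>

lemma abs_gs_coeff_le:
  assumes "a > 0" "a - 2 * b + 2 \<ge> 0" "a + b + 1 / 2 \<ge> 2 * \<bar>b * (1 - 2 * b)\<bar>"
    "a - b + 1 > 0" "a + b + 1 / 2 > 0"
  shows "\<bar>gs_coeff a b k\<bar> \<le> (1 / 2) ^ k"
proof (induction k)
  case (Suc k)
  define A where "A = a - b + 1 + k"
  define B where "B = a + b + 1 / 2 + k"
  have pos: "A > 0" "B > 0" using assms by (auto simp: A_def B_def)
  have 1: "2 * a + k \<le> 4 * A" using assms by (simp add: A_def)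
  have 2: "\<bar>(2 * b + k) * (1 - 2 * b + k)\<bar> \<le> (k + 1) * B"
  proof -
    \<comment> \<open>The mixed terms in \<open>b\<close> and \<open>k\<close> cancel; the constant
      that remains is absorbed by \<open>a + b + 1 / 2\<close> through the third assumption.\<close>
    have "(2 * b + k) * (1 - 2 * b + k) = 2 * (b * (1 - 2 * b)) + k + real k * k"
      by (simp add: algebra_simps)
    moreover have "(k + 1) * B = (a + b + 1 / 2) + k + real k * k + k * (a + b + 1 / 2)"
      by (simp add: field_simps B_def)
    moreover have "k * (a + b + 1 / 2) \<ge> 0" using assms by simp
    moreover have "real k * k \<ge> 0" by simp
    ultimately show ?thesis using assms(3) by linarith
  qed
  have "(2 * a + k) * \<bar>(2 * b + k) * (1 - 2 * b + k)\<bar> \<le> (4 * A) * ((k + 1) * B)"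
    by (rule mult_mono[OF 1 2]) (use pos in auto)
  hence "(2 * a + k) * \<bar>(2 * b + k) * (1 - 2 * b + k)\<bar> \<le> 1 / 2 * (8 * (real k + 1) * A * B)"
    by (simp add: algebra_simps)
  hence "(2 * a + k) * \<bar>(2 * b + k) * (1 - 2 * b + k)\<bar> / (8 * (real k + 1) * A * B) \<le> 1 / 2"
    by (subst pos_divide_le_eq) (use pos in auto)
  moreover have "\<bar>- ((2 * a + k) * (2 * b + k) * (1 - 2 * b + k)) / (8 * (real k + 1) * A * B)\<bar> =
      (2 * a + k) * \<bar>(2 * b + k) * (1 - 2 * b + k)\<bar> / (8 * (real k + 1) * A * B)"
    using pos assms(1)
    by (simp add: abs_mult mult_ac del: distrib_left_numeral distrib_right_numeral)
  ultimately have "\<bar>- ((2 * a + k) * (2 * b + k) * (1 - 2 * b + k)) / (8 * (real k + 1) * A * B)\<bar> \<le> 1 / 2"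
    by simp
  from mult_mono[OF Suc this]
  show ?case unfolding gs_coeff_Suc A_def[symmetric] B_def[symmetric] by (simp add: abs_mult mult_ac)
qed simp

lemma summable_linear_geometric: "summable (\<lambda>k. (1 + 3 * real k) * (1 / 2) ^ k)"
proof (rule summable_ratio_test[of "3 / 4" 2])
  fix k :: nat assume "k \<ge> 2"
  \<comment> \<open>This amounts to 3 k >= 5, hence the threshold 2.\<close>
  hence "(4 + 3 * real k) / 2 \<le> 3 / 4 * (1 + 3 * real k)" by simp
  hence "(4 + 3 * real k) / 2 * (1 / 2) ^ k \<le> 3 / 4 * (1 + 3 * real k) * (1 / 2) ^ k"
    by (rule mult_right_mono) simp
  moreover have "norm ((1 + 3 * real (Suc k)) * (1 / 2 :: real) ^ Suc k) = (4 + 3 * real k) / 2 * (1 / 2) ^ k"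
    by simp
  moreover have "norm ((1 + 3 * real k) * (1 / 2 :: real) ^ k) = (1 + 3 * real k) * (1 / 2) ^ k"
    by simp
  ultimately show "norm ((1 + 3 * real (Suc k)) * (1 / 2 :: real) ^ Suc k) \<le>
      3 / 4 * norm ((1 + 3 * real k) * (1 / 2 :: real) ^ k)"
    by (simp only: mult.assoc)
qed simp

text \<open>Each quotient of consecutive coefficients has \<open>a\<close> once in the numerator and
  twice in the denominator, so it tends to 0 and only the 0-th coefficient survives. The linear
  factor tends to 1.\<close>

lemma gs_term_tendsto:
  "(\<lambda>n. gs_term (a + real n) b k) \<longlonglongrightarrow> (if k = 0 then 1 else 0)"
proof -
  have c: "(\<lambda>n. gs_coeff (a + real n) b k) \<longlonglongrightarrow> (if k = 0 then 1 else 0)"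
  proof (induction k)
    case (Suc k)
    have "(\<lambda>n. - ((2 * (a + real n) + real k) * (2 * b + real k) * (1 - 2 * b + real k)) /
        (8 * (real k + 1) * (a + real n - b + 1 + real k) * (a + real n + b + 1 / 2 + real k)))
        \<longlonglongrightarrow> 0"
      by real_asymp
    from tendsto_mult[OF Suc this]
    have "(\<lambda>n. gs_coeff (a + real n) b (Suc k)) \<longlonglongrightarrow> (if k = 0 then 1 else 0) * 0"
      unfolding gs_coeff_Suc .
    thus ?case by simp
  qed simp
  have "(\<lambda>n. (2 * (a + real n) + 3 * real k) / (2 * (a + real n))) \<longlonglongrightarrow> 1"
    by real_asymp
  from tendsto_mult[OF this c] show ?thesis unfolding gs_term_def by simp
qed

lemma suminf_gs_term_tendsto: "(\<lambda>n. suminf (gs_term (a + real n) b)) \<longlonglongrightarrow> 1"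
proof -
  \<comment> \<open>For \<open>real n \<ge> C\<close>, the parameter \<open>a + real n\<close> is at
    least 1 + 2|b| + 2|b (1 - 2b)|, which yields both \<open>a' \<ge> 1\<close> and all hypotheses
    of \<open>abs_gs_coeff_le\<close>.\<close>
  define C where "C = 1 + \<bar>a\<bar> + 2 * \<bar>b\<bar> + 2 * \<bar>b * (1 - 2 * b)\<bar>"
  have bound: "norm (gs_term (a + real n) b k) \<le> (1 + 3 * real k) * (1 / 2) ^ k"
    if "real n \<ge> C" for n k
  proof -
    define a' where "a' = a + real n"
    have "a' \<ge> 1" using that unfolding a'_def C_def by linarith
    hence 1: "0 \<le> (2 * a' + 3 * real k) / (2 * a')"
      "(2 * a' + 3 * real k) / (2 * a') \<le> 1 + 3 * real k"
      using mult_left_mono[of 1 "2 * a'" "real k"] by (simp_all add: field_simps)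
    have 2: "\<bar>gs_coeff a' b k\<bar> \<le> (1 / 2) ^ k"
      by (rule abs_gs_coeff_le) (use that in \<open>unfold a'_def C_def, linarith+\<close>)
    show ?thesis unfolding a'_def[symmetric] gs_term_def real_norm_def abs_mult
      by (rule mult_mono) (use 1 2 in auto)
  qed
  have "eventually (\<lambda>n. real n \<ge> C) sequentially" by real_asymp
  hence "eventually (\<lambda>(k, n). norm (gs_term (a + real n) b k) \<le> (1 + 3 * real k) * (1 / 2) ^ k)
      (at_top \<times>\<^sub>F sequentially)"
    unfolding eventually_prod_filter using bound
    by (intro exI[of _ "\<lambda>_. True"] exI[of _ "\<lambda>n. real n \<ge> C"]) auto
  from tannerys_theorem[OF gs_term_tendsto this summable_linear_geometric]
  have "(\<lambda>n. suminf (gs_term (a + real n) b)) \<longlonglongrightarrow> (\<Sum>k. if k = 0 then 1 else 0 :: real)"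
    by simp
  also have "(\<Sum>k. if k = 0 then 1 else 0 :: real) = 1"
    using sums_unique[OF sums_single[of 0 "\<lambda>_. 1 :: real"]] by simp
  finally show ?thesis .
qed

section \<open>The infinite product as a Gamma quotient\<close>

text \<open>Gauss's limit formula for Gamma is applied to each symbol; the balance condition
  \<open>x + y = z + w\<close> makes the powers of \<open>n\<close> cancel.\<close>

lemma pochhammer_quotient_tendsto:
  fixes x y z w :: real
  assumes "x > 0" "y > 0" "z > 0" "w > 0" "x + y = z + w"
  shows "(\<lambda>n. pochhammer x n * pochhammer y n / (pochhammer z n * pochhammer w n))
     \<longlonglongrightarrow> Gamma z * Gamma w / (Gamma x * Gamma y)"
proof -
  have "(\<lambda>n. Gamma_series z n * Gamma_series w n / (Gamma_series x n * Gamma_series y n))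
     \<longlonglongrightarrow> Gamma z * Gamma w / (Gamma x * Gamma y)"
    using assms by (intro tendsto_intros) (auto simp: Gamma_eq_zero_iff elim!: nonpos_Ints_cases)
  moreover have "Gamma_series z n * Gamma_series w n / (Gamma_series x n * Gamma_series y n) =
    pochhammer x (Suc n) * pochhammer y (Suc n) / (pochhammer z (Suc n) * pochhammer w (Suc n))" for n
  proof -
    have "exp (z * ln (real n)) * exp (w * ln (real n)) = exp (x * ln (real n)) * exp (y * ln (real n))"
      using assms(5) by (metis distrib_right exp_add)
    thus ?thesis unfolding Gamma_series_def by (simp add: field_simps del: mult_exp_exp)
  qed
  \<comment> \<open>\<open>Gamma_series\<close> at \<open>n\<close> contains the symbol of length
    \<open>Suc n\<close>, so the limit is obtained for the shifted sequence first.\<close>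
  ultimately show ?thesis using LIMSEQ_imp_Suc by simp
qed

theorem gs_term_sums:
  assumes "a > 0" "a - b + 1 > 0" "a + b + 1 / 2 > 0"
  shows "gs_term a b sums
    (Gamma (a - b + 1) * Gamma (a + b + 1 / 2) / (Gamma (a + 1 / 2) * Gamma (a + 1)))"
proof -
  have "(\<lambda>n. suminf (gs_term (a + real n) b)) \<longlonglongrightarrow>
    Gamma (a + 1 / 2) * Gamma (a + 1) / (Gamma (a - b + 1) * Gamma (a + b + 1 / 2)) *
      suminf (gs_term a b)"
    unfolding suminf_gs_term_plus_nat[OF assms]
    \<comment> \<open>The parameters balance: both pairs add up to 2a + 3/2.\<close>
    by (intro tendsto_mult tendsto_const pochhammer_quotient_tendsto) (use assms in auto)
  from LIMSEQ_unique[OF this suminf_gs_term_tendsto]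
  have "suminf (gs_term a b) =
      Gamma (a - b + 1) * Gamma (a + b + 1 / 2) / (Gamma (a + 1 / 2) * Gamma (a + 1))"
    \<comment> \<open>The Gamma quotient times the sum equals 1, so the quotient is nonzero and can
      be inverted.\<close>
    by (metis divide_eq_0_iff divide_divide_eq_right eq_divide_imp mult.commute mult_1 mult_zero_left zero_neq_one)
  thus ?thesis using summable_sums[OF summable_gs_term[OF assms]] by simp
qed

section \<open>Gamma at half-integers\<close>

lemma half_plus_of_int_not_nonpos_Ints: "1 / 2 + of_int n \<notin> (\<int>\<^sub>\<le>\<^sub>0 :: real set)"
proof
  assume "1 / 2 + of_int n \<in> (\<int>\<^sub>\<le>\<^sub>0 :: real set)"
  then obtain m where "1 / 2 + of_int n = (of_int m :: real)" by (auto elim!: nonpos_Ints_cases)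
  hence "(of_int (1 + 2 * n) :: real) = of_int (2 * m)" by simp
  hence "1 + 2 * n = 2 * m" by (simp only: of_int_eq_iff)
  thus False by presburger
qed

lemma shifted_factorial_half:
  "shifted_factorial (1 / 2) n = complex_of_real (Gamma (1 / 2 + of_int n) / sqrt pi)"
  using Gamma_complex_of_real[of "1 / 2 + of_int n"]
  by (simp add: shifted_factorial_def Gamma_one_half_complex)

text \<open>This isolates the dependence on \<open>k\<close>. The integer \<open>n\<close> may be
  negative, but \<open>1 / 2 + of_int n\<close> is never a pole.\<close>

lemma Gamma_half_plus_nat:
  "Gamma (1 / 2 + of_int n + real k) = Gamma (1 / 2 + of_int n) * pochhammer (1 / 2 + of_int n) k"
  using pochhammer_Gamma[OF half_plus_of_int_not_nonpos_Ints[of n], of k]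
    half_plus_of_int_not_nonpos_Ints[of n] by (simp add: Gamma_eq_zero_iff)

text \<open>Euler's reflection formula; since the shift \<open>2 * q\<close> is even, the sine in
  the denominator is +1 for every \<open>q\<close>.\<close>

lemma Gamma_half_reflection:
  "Gamma (1 / 2 + of_int (2 * q)) * Gamma (1 / 2 - of_int (2 * q)) = pi"
proof -
  have "sin (pi * (1 / 2 + of_int (2 * q))) = 1"
    using sin_int_2pin[of q] cos_int_2pin[of q] by (simp add: distrib_left sin_add mult_ac)
  hence "sin (of_real pi * (1 / 2 + of_int (2 * q))) = (1 :: complex)"
    using sin_of_real[of "pi * (1 / 2 + of_int (2 * q))", where 'a = complex] by simp
  hence "Gamma (1 / 2 + of_int (2 * q)) * Gamma (1 / 2 - of_int (2 * q)) = complex_of_real pi"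
    using Gamma_reflection_complex[of "1 / 2 + of_int (2 * q)"] by simp
  hence "complex_of_real (Gamma (1 / 2 + of_int (2 * q)) * Gamma (1 / 2 - of_int (2 * q))) = of_real pi"
    by (simp flip: Gamma_complex_of_real)
  thus ?thesis by (simp only: of_real_eq_iff)
qed

lemma Gamma_legendre_duplication_real:
  fixes x :: real
  assumes "x > 0"
  shows "Gamma x * Gamma (x + 1 / 2) = 2 powr (1 - 2 * x) * sqrt pi * Gamma (2 * x)"
proof -
  have "complex_of_real x \<notin> \<int>\<^sub>\<le>\<^sub>0" "complex_of_real (x + 1 / 2) \<notin> \<int>\<^sub>\<le>\<^sub>0"
    using assms by (auto simp only: of_real_in_nonpos_Ints_iff dest!: nonpos_Ints_nonpos)
  with Gamma_legendre_duplication[of "of_real x"]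
  have "complex_of_real (Gamma x * Gamma (x + 1 / 2)) =
      of_real (2 powr (1 - 2 * x) * sqrt pi * Gamma (2 * x))"
    by (simp add: powr_def flip: Gamma_complex_of_real exp_of_real)
  thus ?thesis by (simp only: of_real_eq_iff)
qed

section \<open>Specialisation to quarter-integer parameters\<close>

theorem theorem3:
  fixes p q :: int
  assumes "min (p + q) (p - q) \<ge> 0"
  shows "(\<lambda>k::nat.
            (shifted_factorial (1/2) (int k + 2 * p) *
             shifted_factorial (1/2) (int k + 2 * q) *
             shifted_factorial (1/2) (int k - 2 * q)) /
            (fact k * fact (nat (int k + p + q)) * fact (nat (int k + p - q))) *
            (of_int (6 * int k + 4 * p + 1) / (- 8) ^ k))
         sums (4 powi (p + 1) / (complex_of_real (sqrt 2) * complex_of_real pi))"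
proof -
  \<comment> \<open>With these values \<open>2 * a\<close>, \<open>2 * b\<close> and
    \<open>1 - 2 * b\<close> are 1/2 shifted by 2p, 2q and -2q, while the lower parameters become
    positive integers, whose Pochhammer symbols are quotients of factorials.\<close>
  define a b :: real where "a = of_int p + 1 / 4" and "b = of_int q + 1 / 4"
  define m n where "m = nat (p + q)" and "n = nat (p - q)"
  have m: "of_int p + of_int q = real m" and n: "of_int p - of_int q = real n"
    using assms by (simp_all add: m_def n_def of_nat_nat)
  have p: "p \<ge> 0" using assms by simp
  have ab: "a > 0" "a - b + 1 = 1 + real n" "a + b + 1 / 2 = 1 + real m"
    using p by (simp_all add: a_def b_def flip: m n)
  \<comment> \<open>This is the summand at \<open>k = 0\<close>: \<open>4 * a\<close> equals 4p + 1,
    and \<open>pi * sqrt pi\<close> collects three factors Gamma(1/2).\<close>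
  define C where "C = Gamma (1 / 2 + of_int (2 * p)) *
    (Gamma (1 / 2 + of_int (2 * q)) * Gamma (1 / 2 + of_int (- (2 * q)))) / (pi * sqrt pi) *
    (4 * a) / (fact n * fact m)"
  have Gpos: "Gamma (1 / 2 + of_int (2 * p) :: real) > 0"
    using p by (intro Gamma_real_pos) auto
  have term_eq: "(shifted_factorial (1/2) (int k + 2 * p) *
             shifted_factorial (1/2) (int k + 2 * q) *
             shifted_factorial (1/2) (int k - 2 * q)) /
            (fact k * fact (nat (int k + p + q)) * fact (nat (int k + p - q))) *
            (of_int (6 * int k + 4 * p + 1) / (- 8) ^ k) = complex_of_real (C * gs_term a b k)" for k
  proof -
    have G: "Gamma (1 / 2 + of_int (int k + j)) =
        Gamma (1 / 2 + of_int j) * (pochhammer (1 / 2 + of_int j) k :: real)" for j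
      using Gamma_half_plus_nat[of j k] by (simp add: add_ac)
    \<comment> \<open>The assumption makes both arguments nonnegative, so \<open>nat\<close>
      truncates nothing.\<close>
    have nats: "nat (int k + p + q) = m + k" "nat (int k + p - q) = n + k"
      using assms by (auto simp: m_def n_def nat_add_distrib)
    have fact: "fact (l + k) = fact l * pochhammer (1 + real l) k" for l
      using pochhammer_product'[of "1 :: real" l k] by (simp add: pochhammer_fact)
    have arg: "1 / 2 + of_int (2 * p) = 2 * a" "1 / 2 + of_int (2 * q) = 2 * b"
      "1 / 2 + of_int (- (2 * q)) = 1 - 2 * b"
      by (simp_all add: a_def b_def)
    have lin: "of_int (6 * int k + 4 * p + 1) = 2 * (2 * a + 3 * real k)"
      by (simp add: a_def)
    have pow: "(- 1 / 8 :: real) ^ k = 1 / (- 8) ^ k"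
      by (simp flip: power_one_over)
    have minus: "int k - 2 * q = int k + (- (2 * q))" by simp
    have "(Gamma (1 / 2 + of_int (int k + 2 * p)) / sqrt pi *
           (Gamma (1 / 2 + of_int (int k + 2 * q)) / sqrt pi) *
           (Gamma (1 / 2 + of_int (int k + (- (2 * q)))) / sqrt pi)) /
          (fact k * fact (m + k) * fact (n + k)) *
          (of_int (6 * int k + 4 * p + 1) / (- 8) ^ k) = C * gs_term a b k"
      unfolding G fact C_def gs_term_def gs_coeff_def ab(2,3) lin pow arg using ab(1)
      by (simp add: divide_simps) (simp add: algebra_simps)?
    hence "complex_of_real ((Gamma (1 / 2 + of_int (int k + 2 * p)) / sqrt pi *
           (Gamma (1 / 2 + of_int (int k + 2 * q)) / sqrt pi) *
           (Gamma (1 / 2 + of_int (int k + (- (2 * q)))) / sqrt pi)) /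
          (fact k * fact (m + k) * fact (n + k)) *
          (of_int (6 * int k + 4 * p + 1) / (- 8) ^ k)) = of_real (C * gs_term a b k)"
      by (simp only:)
    thus ?thesis
      unfolding shifted_factorial_half nats minus
      by (simp only: of_real_mult of_real_divide of_real_fact of_real_of_int_eq of_real_power
        of_real_minus of_real_numeral)
  qed
  \<comment> \<open>Reflection removes the Gamma values with \<open>q\<close> from \<open>C\<close>,
    the upper Gamma values cancel the factorials, and duplication at \<open>a + 1 / 2\<close>
    produces the same Gamma(1/2 + 2p) as in \<open>C\<close>, leaving only powers of 2 and
    pi.\<close>
  have val: "C * (Gamma (a - b + 1) * Gamma (a + b + 1 / 2) / (Gamma (a + 1 / 2) * Gamma (a + 1))) =
      4 powi (p + 1) / (sqrt 2 * pi)"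
  proof -
    have "Gamma (2 * (a + 1 / 2)) = 2 * a * Gamma (1 / 2 + of_int (2 * p))"
    proof -
      have "2 * (a + 1 / 2) = 2 * a + 1" "1 / 2 + of_int (2 * p) = 2 * a"
        by (simp_all add: a_def)
      thus ?thesis
        using Gamma_plus1[of "2 * a"] ab(1) nonpos_Ints_nonpos[of "2 * a"] by auto
    qed
    moreover have "2 powr (1 - 2 * (a + 1 / 2)) = 1 / (sqrt 2 * 4 powi p)"
    proof -
      have "(2 :: real) powr (2 * of_int p) = (2 powr 2) powr of_int p"
        by (simp only: powr_powr)
      also have "\<dots> = 4 powi p"
        by (simp add: powr_real_of_int')
      finally have "2 powr (1 / 2 + 2 * of_int p) = sqrt 2 * 4 powi p"
        by (simp add: powr_add powr_half_sqrt)
      moreover have "1 - 2 * (a + 1 / 2) = - (1 / 2 + 2 * of_int p)"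
        by (simp add: a_def)
      ultimately show ?thesis
        by (simp only: powr_minus_divide)
    qed
    ultimately have dupl: "Gamma (a + 1 / 2) * Gamma (a + 1) =
        1 / (sqrt 2 * 4 powi p) * sqrt pi * (2 * a * Gamma (1 / 2 + of_int (2 * p)))"
      using Gamma_legendre_duplication_real[of "a + 1 / 2"] ab(1) by (simp add: add_ac)
    have C: "C = Gamma (1 / 2 + of_int (2 * p)) * (4 * a) / (sqrt pi * fact n * fact m)"
      using Gamma_half_reflection[of q] by (simp add: C_def)
    have "C * (Gamma (a - b + 1) * Gamma (a + b + 1 / 2) / (Gamma (a + 1 / 2) * Gamma (a + 1))) =
        2 * sqrt 2 * 4 powi p / pi"
      unfolding dupl ab(2,3) C Gamma_fact using ab(1) Gpos by (simp add: divide_simps)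
    also have "\<dots> = 4 powi (p + 1) / (sqrt 2 * pi)"
      by (simp add: power_int_add divide_simps)
    finally show ?thesis .
  qed
  have "(\<lambda>k. C * gs_term a b k) sums (4 powi (p + 1) / (sqrt 2 * pi))"
    unfolding val[symmetric] by (intro sums_mult gs_term_sums) (use ab in auto)
  hence "(\<lambda>k. complex_of_real (C * gs_term a b k)) sums of_real (4 powi (p + 1) / (sqrt 2 * pi))"
    by (subst sums_of_real_iff)
  thus ?thesis unfolding term_eq by simp
qed

end
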